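(* If $G$ is a König–Egerváry graph, then: (i) there are no $\mu$-critical edges of $G$ in $(\ker(G),N(\ker(G)))$; (ii) there are no $\mu$-critical edges of $G$ in $(\mathrm{core}(G)-\ker(G),N(\ker(G)))$; (iii) the only possible location for $\mu$-critical edges of $G$ in $(\mathrm{core}(G),N(\mathrm{core}(G)))$ is $(\mathrm{core}(G)-\ker(G),\,N(\mathrm{core}(G))-N(\ker(G)))$; (iv) the maximum possible number of $\mu$-critical edges of $G$ in $(\mathrm{core}(G),N(\mathrm{core}(G)))$ is equal to $\xi(G)-\varepsilon(G)$; (v) $\varrho_e(G)\geq m(G)-\xi(G)+\varepsilon(G)$.
   Context: All graphs are finite, undirected, without loops or multiple edges; $n(G)=|V(G)|$, $m(G)=|E(G)|$. $\alpha(G)$ is the maximum size of an independent set of $G$ and $\mu(G)$ is the maximum size of a matching of $G$. $G$ is a König–Egerváry graph if $\alpha(G)+\mu(G)=n(G)$. For $A\subseteq V(G)$, $N(A)$ is the set of vertices having at least one neighbor in $A$. For disjoint $A,B\subseteq V(G)$, $(A,B)$ denotes the set of edges $ab\in E(G)$ with $a\in A$, $b\in B$. $d(G)=\max\{|A|-|N(A)|:A\subseteq V(G)\}$ is the critical difference (the maximum is also attained over independent sets), and an independent set $A$ (possibly empty) is a critical independent set if $|A|-|N(A)|=d(G)$. $\ker(G)$ is the intersection of all critical independent sets of $G$, and $\varepsilon(G)=|\ker(G)|$. $\mathrm{core}(G)$ is the intersection of all maximum independent sets of $G$, and $\xi(G)=|\mathrm{core}(G)|$; one always has $\ker(G)\subseteq\mathrm{core}(G)$.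 An edge $e$ is $\mu$-critical if $\mu(G-e)<\mu(G)$, where $G-e$ is obtained by deleting the edge $e$ (keeping all vertices). $\varrho_e(G)$ is the number of edges $e\in E(G)$ such that $G-e$ is a König–Egerváry graph. *)

theory Defs
  imports Main
begin

record 'a ugraph =
  verts :: "'a set"
  edges :: "'a set set"

definition simple_graph :: "'a ugraph \<Rightarrow> bool" where
  "simple_graph G \<longleftrightarrow> finite (verts G) \<and> (\<forall>e\<in>edges G. e \<subseteq> verts G \<and> card e = 2)"

definition num_verts :: "'a ugraph \<Rightarrow> nat" where
  "num_verts G = card (verts G)"

definition num_edges :: "'a ugraph \<Rightarrow> nat" where
  "num_edges G = card (edges G)"

definition delete_edge :: "'a ugraph \<Rightarrow> 'a set \<Rightarrow> 'a ugraph" where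
  "delete_edge G e = G\<lparr>edges := edges G - {e}\<rparr>"

definition nbhd :: "'a ugraph \<Rightarrow> 'a set \<Rightarrow> 'a set" where
  "nbhd G A = {v \<in> verts G. \<exists>a\<in>A. {a, v} \<in> edges G}"

definition edges_between :: "'a ugraph \<Rightarrow> 'a set \<Rightarrow> 'a set \<Rightarrow> 'a set set" where
  "edges_between G A B = {e \<in> edges G. \<exists>a\<in>A. \<exists>b\<in>B. e = {a, b}}"

definition indep_set :: "'a ugraph \<Rightarrow> 'a set \<Rightarrow> bool" where
  "indep_set G A \<longleftrightarrow> A \<subseteq> verts G \<and> (\<forall>x\<in>A. \<forall>y\<in>A. {x, y} \<notin> edges G)"

definition matching :: "'a ugraph \<Rightarrow> 'a set set \<Rightarrow> bool" where
  "matching G M \<longleftrightarrow> M \<subseteq> edges G \<and> pairwise disjnt M"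

definition indep_num :: "'a ugraph \<Rightarrow> nat" where
  "indep_num G = Max (card ` {A. indep_set G A})"

definition matching_num :: "'a ugraph \<Rightarrow> nat" where
  "matching_num G = Max (card ` {M. matching G M})"

definition konig_egervary :: "'a ugraph \<Rightarrow> bool" where
  "konig_egervary G \<longleftrightarrow> indep_num G + matching_num G = num_verts G"

text \<open>The difference may be negative for individual sets, hence the integers.\<close>

definition set_difference :: "'a ugraph \<Rightarrow> 'a set \<Rightarrow> int" where
  "set_difference G A = int (card A) - int (card (nbhd G A))"

definition critical_difference :: "'a ugraph \<Rightarrow> int" where
  "critical_difference G = Max (set_difference G ` {A. A \<subseteq> verts G})"

definition critical_indep_set :: "'a ugraph \<Rightarrow> 'a set \<Rightarrow> bool" where
  "critical_indep_set G A \<longleftrightarrow> indep_set G A \<and> set_difference G A = critical_difference G"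

definition max_indep_set :: "'a ugraph \<Rightarrow> 'a set \<Rightarrow> bool" where
  "max_indep_set G A \<longleftrightarrow> indep_set G A \<and> card A = indep_num G"

text \<open>In a finite graph both intersections below range over nonempty families,
  so they are sets of vertices.\<close>

definition ker :: "'a ugraph \<Rightarrow> 'a set" where
  "ker G = \<Inter> {A. critical_indep_set G A}"

definition core :: "'a ugraph \<Rightarrow> 'a set" where
  "core G = \<Inter> {A. max_indep_set G A}"

definition ker_num :: "'a ugraph \<Rightarrow> nat" where
  "ker_num G = card (ker G)"

definition core_num :: "'a ugraph \<Rightarrow> nat" where
  "core_num G = card (core G)"

definition mu_critical_edges :: "'a ugraph \<Rightarrow> 'a set set" where
  "mu_critical_edges G =
    {e \<in> edges G. matching_num (delete_edge G e) < matching_num G}"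

definition ke_edge_num :: "'a ugraph \<Rightarrow> nat" where
  "ke_edge_num G = card {e \<in> edges G. konig_egervary (delete_edge G e)}"

definition core_critical_edges :: "'a ugraph \<Rightarrow> 'a set set" where
  "core_critical_edges G = mu_critical_edges G \<inter> edges_between G (core G) (nbhd G (core G))"

end

theory Submission
  imports Defs
begin

text \<open>Submodularity of the neighbourhood size makes \<^term>\<open>ker G\<close> the least critical independent set, so
  every nonempty set J of neighbours of the kernel has at least card J + 1 neighbours in it. By
  Hall's theorem the neighbours of the kernel can be matched into the kernel while avoiding any
  prescribed kernel vertex; exchanging this for the part of a maximum matching near the kernel
  shows that no edge at a neighbour of the kernel is \<open>\<mu>\<close>-critical. The remaining critical edges lie
  in a single maximum matching, so distinct ones use distinct vertices of the core outside the
  kernel.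

  An edge whose deletion destroys the Koenig-Egervary property is \<open>\<mu>\<close>-critical. If it had no end
  in the core, maximum independent sets S and T would omit one end each, and a Hall violator for
  matching the complement of S into S without the edge would show how to combine S and T into an
  independent set of the reduced graph with one vertex more.\<close>

section \<open>Hall's theorem\<close>

text \<open>Induction on \<open>card I\<close>. If some nonempty proper \<open>J\<close> is tight,
  \<open>J\<close> and \<open>I - J\<close> are treated separately, the latter without the values
  that occur for \<open>J\<close>. Otherwise every nonempty proper subset has a spare value, so any
  choice at one index is safe.\<close>

theorem hall:
  assumes "finite I" and "\<And>i. i \<in> I \<Longrightarrow> finite (A i)"
    and "\<And>J. J \<subseteq> I \<Longrightarrow> card J \<le> card (\<Union>(A ` J))"
  shows "\<exists>f. inj_on f I \<and> (\<forall>i\<in>I. f i \<in> A i)"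
  using assms
proof (induction "card I" arbitrary: I A rule: less_induct)
  case less
  note fin = less.prems(1,2) and cond = less.prems(3)
  show ?case
  proof (cases "I = {}")
    case False
    then obtain i where i: "i \<in> I" by blast
    show ?thesis
    proof (cases "\<exists>J. J \<subset> I \<and> J \<noteq> {} \<and> card (\<Union>(A ` J)) \<le> card J")
      case True
      then obtain J where J: "J \<subset> I" "J \<noteq> {}" "card (\<Union>(A ` J)) \<le> card J" by blast
      define U where "U = \<Union>(A ` J)"
      have finJ: "finite J" using J(1) fin(1) finite_subset by blast
      have finU: "finite U" using J(1) finJ fin(2) by (auto simp: U_def)
      have "card J < card I" using J(1) fin(1) psubset_card_mono by blast
      then have "\<exists>f. inj_on f J \<and> (\<forall>i\<in>J. f i \<in> A i)"
        by (rule less.hyps) (use finJ J(1) fin(2) in \<open>auto intro!: cond\<close>)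
      then obtain f where f: "inj_on f J" "\<forall>i\<in>J. f i \<in> A i" by blast
      have "card (I - J) < card I"
        by (rule psubset_card_mono) (use J fin in auto)
      \<comment> \<open>Hall's condition for \<open>K \<union> J\<close>, less the at most
        \<open>card J\<close> values in \<open>U\<close>.\<close>
      moreover have "card K \<le> card (\<Union>((\<lambda>i. A i - U) ` K))" if K: "K \<subseteq> I - J" for K
      proof -
        have finK: "finite K" using K fin(1) finite_subset by blast
        have "card K + card J = card (K \<union> J)"
          using K finK finJ by (subst card_Un_disjoint) auto
        also have "\<dots> \<le> card (\<Union>(A ` (K \<union> J)))"
          using K J(1) by (intro cond) auto
        also have "\<Union>(A ` (K \<union> J)) = \<Union>((\<lambda>i. A i - U) ` K) \<union> U"
          by (auto simp: U_def)
        also have "card \<dots> \<le> card (\<Union>((\<lambda>i. A i - U) ` K)) + card U"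
          by (rule card_Un_le)
        finally show ?thesis using J(3) by (simp add: U_def)
      qed
      ultimately have "\<exists>g. inj_on g (I - J) \<and> (\<forall>i\<in>I - J. g i \<in> A i - U)"
        using fin by (intro less.hyps) auto
      then obtain g where g: "inj_on g (I - J)" "\<forall>i\<in>I - J. g i \<in> A i - U" by blast
      have "inj_on (\<lambda>i. if i \<in> J then f i else g i) I"
      proof (rule inj_onI)
        fix a b
        assume ab: "a \<in> I" "b \<in> I"
          and eq: "(if a \<in> J then f a else g a) = (if b \<in> J then f b else g b)"
        have fU: "f c \<in> U" if "c \<in> J" for c using f(2) that by (auto simp: U_def)
        have gU: "g c \<notin> U" if "c \<in> I" "c \<notin> J" for c using g(2) that by auto
        show "a = b"
        proof (cases "a \<in> J")
          case True
          then have "b \<in> J" using eq fU gU[of b] ab by (auto split: if_splits) metis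
          then show ?thesis using True eq f(1) by (auto dest: inj_onD)
        next
          case False
          then have "b \<notin> J" using eq fU[of b] gU[of a] ab by (auto split: if_splits)
          then show ?thesis using False eq g(1) ab by (auto dest: inj_onD)
        qed
      qed
      moreover have "\<forall>i\<in>I. (if i \<in> J then f i else g i) \<in> A i" using f(2) g(2) by auto
      ultimately show ?thesis by blast
    next
      case False
      have "A i \<noteq> {}" using cond[of "{i}"] i by auto
      then obtain x where x: "x \<in> A i" by blast
      have "card (I - {i}) < card I" using i fin(1) by (intro card_Diff1_less)
      \<comment> \<open>The strict inequality for proper subsets pays for the loss of
        \<open>x\<close>.\<close>
      moreover have "card J \<le> card (\<Union>((\<lambda>j. A j - {x}) ` J))" if J: "J \<subseteq> I - {i}" for J
      proof (cases "J = {}")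
        case ne: False
        have finJ: "finite J" using J fin(1) finite_subset by blast
        have "J \<subset> I" using J i by blast
        then have "card J < card (\<Union>(A ` J))" using False ne not_le by blast
        moreover have "\<Union>((\<lambda>j. A j - {x}) ` J) = \<Union>(A ` J) - {x}" by blast
        ultimately show ?thesis by (auto simp: card_Diff_singleton_if)
      qed simp
      ultimately have "\<exists>f. inj_on f (I - {i}) \<and> (\<forall>j\<in>I - {i}. f j \<in> A j - {x})"
        using fin by (intro less.hyps) auto
      then obtain f where f: "inj_on f (I - {i})" "\<forall>j\<in>I - {i}. f j \<in> A j - {x}" by blast
      have "inj_on (f(i := x)) I"
        using f by (fastforce simp: inj_on_def)
      moreover have "\<forall>j\<in>I. (f(i := x)) j \<in> A j" using f(2) x by auto
      ultimately show ?thesis by blast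
    qed
  qed simp
qed

section \<open>Independent sets and matchings\<close>

lemma finite_verts: "simple_graph G \<Longrightarrow> finite (verts G)"
  by (simp add: simple_graph_def)

lemma finite_edges: "simple_graph G \<Longrightarrow> finite (edges G)"
  by (rule finite_subset[of _ "Pow (verts G)"]) (auto simp: simple_graph_def)

lemma edgeE:
  assumes "simple_graph G" "e \<in> edges G"
  obtains u v where "e = {u, v}" "u \<noteq> v" "u \<in> verts G" "v \<in> verts G"
  using assms unfolding simple_graph_def by (metis card_2_iff insert_subset)

lemma edge_verts:
  assumes "simple_graph G" "{u, v} \<in> edges G"
  shows "u \<in> verts G" "v \<in> verts G" "u \<noteq> v"
  using assms unfolding simple_graph_def by fastforce+

lemma in_nbhd_iff:
  "simple_graph G \<Longrightarrow> v \<in> nbhd G A \<longleftrightarrow> (\<exists>a\<in>A. {a, v} \<in> edges G)"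
  by (auto simp: nbhd_def dest: edge_verts)

lemma nbhd_subset: "nbhd G A \<subseteq> verts G"
  by (auto simp: nbhd_def)

lemma finite_nbhd: "simple_graph G \<Longrightarrow> finite (nbhd G A)"
  using nbhd_subset finite_verts finite_subset by metis

lemma finite_indep: "simple_graph G \<Longrightarrow> indep_set G A \<Longrightarrow> finite A"
  using finite_verts finite_subset by (metis indep_set_def)

lemma finite_matching: "simple_graph G \<Longrightarrow> matching G M \<Longrightarrow> finite M"
  using finite_edges finite_subset by (metis matching_def)

lemma finite_indep_sets: "simple_graph G \<Longrightarrow> finite {A. indep_set G A}"
  by (rule finite_subset[of _ "Pow (verts G)"]) (auto simp: indep_set_def finite_verts)

lemma finite_matchings: "simple_graph G \<Longrightarrow> finite {M. matching G M}"
  by (rule finite_subset[of _ "Pow (edges G)"]) (auto simp: matching_def finite_edges)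

lemma card_le_indep_num: "simple_graph G \<Longrightarrow> indep_set G A \<Longrightarrow> card A \<le> indep_num G"
  unfolding indep_num_def using finite_indep_sets by (intro Max_ge) auto

lemma card_le_matching_num: "simple_graph G \<Longrightarrow> matching G M \<Longrightarrow> card M \<le> matching_num G"
  unfolding matching_num_def using finite_matchings by (intro Max_ge) auto

lemma max_indep_set_exists:
  assumes "simple_graph G"
  obtains A where "max_indep_set G A"
proof -
  have "indep_set G {}" by (simp add: indep_set_def)
  then have "indep_num G \<in> card ` {A. indep_set G A}"
    unfolding indep_num_def using assms finite_indep_sets by (intro Max_in) auto
  then show ?thesis using that by (auto simp: max_indep_set_def)
qed

lemma max_matching_exists:
  assumes "simple_graph G"
  obtains M where "matching G M" "card M = matching_num G"
proof -
  have "matching G {}" by (simp add: matching_def)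
  then have "matching_num G \<in> card ` {M. matching G M}"
    unfolding matching_num_def using assms finite_matchings by (intro Max_in) auto
  then show ?thesis using that by auto
qed

lemma matching_edge_unique:
  "matching G M \<Longrightarrow> e \<in> M \<Longrightarrow> f \<in> M \<Longrightarrow> v \<in> e \<Longrightarrow> v \<in> f \<Longrightarrow> e = f"
  unfolding matching_def pairwise_def disjnt_def by blast

lemma inj_on_matching:
  assumes "matching G M" "N \<subseteq> M" "\<And>e. e \<in> N \<Longrightarrow> h e \<in> e"
  shows "inj_on h N"
proof (rule inj_onI)
  fix p q assume "p \<in> N" "q \<in> N" "h p = h q"
  moreover from this have "h p \<in> q" using assms(3)[of q] by simp
  ultimately show "p = q"
    using matching_edge_unique[OF assms(1), of p q "h p"] assms(2,3) by blast
qed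

lemma edge_leaves_indep:
  assumes "simple_graph G" "indep_set G S" "e \<in> edges G"
  shows "\<exists>v. v \<in> e \<and> v \<in> verts G - S"
  using assms by (elim edgeE) (auto simp: indep_set_def)

text \<open>Choosing an end outside \<open>S\<close> in each edge is injective because matching
  edges are disjoint. This is weak duality between matchings and the vertex cover
  \<open>verts G - S\<close>.\<close>

lemma matching_into_compl_indep:
  assumes G: "simple_graph G" and S: "indep_set G S" and M: "matching G M"
  shows "\<exists>g. inj_on g M \<and> g ` M \<subseteq> verts G - S \<and> (\<forall>e\<in>M. g e \<in> e)"
proof -
  have "\<forall>e\<in>M. \<exists>v. v \<in> e \<and> v \<in> verts G - S"
    using edge_leaves_indep[OF G S] M by (auto simp: matching_def)
  then obtain g where g: "\<forall>e\<in>M. g e \<in> e \<and> g e \<in> verts G - S" by metis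
  then have "inj_on g M" using inj_on_matching[OF M subset_refl] by blast
  then show ?thesis using g by blast
qed

lemma matching_le_compl_indep:
  assumes "simple_graph G" "indep_set G S" "matching G M"
  shows "card M \<le> card (verts G - S)"
  using matching_into_compl_indep[OF assms] finite_verts[OF assms(1)]
  by (meson card_inj_on_le finite_Diff)

lemma card_compl_indep:
  "simple_graph G \<Longrightarrow> indep_set G S \<Longrightarrow> card S + card (verts G - S) = num_verts G"
  unfolding num_verts_def indep_set_def
  by (metis card_Diff_subset card_mono finite_subset finite_verts le_add_diff_inverse)

lemma indep_matching_le:
  assumes "simple_graph G" "indep_set G S" "matching G M"
  shows "card S + card M \<le> num_verts G"
  using matching_le_compl_indep[OF assms] card_compl_indep[OF assms(1,2)] by linarith

lemma indep_num_matching_num_le: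
  assumes "simple_graph G"
  shows "indep_num G + matching_num G \<le> num_verts G"
  using indep_matching_le[OF assms] max_indep_set_exists[OF assms] max_matching_exists[OF assms]
  by (metis max_indep_set_def)

section \<open>Independent sets and matchings that together attain the order of the graph\<close>

lemma konig_egervaryI:
  assumes G: "simple_graph G" and "indep_set G S" "matching G M"
    and "num_verts G \<le> card S + card M"
  shows "konig_egervary G" "indep_num G = card S" "matching_num G = card M"
  using indep_num_matching_num_le[OF G] card_le_indep_num[OF G assms(2)]
    card_le_matching_num[OF G assms(3)] assms(4)
  by (auto simp: konig_egervary_def)

text \<open>Equality makes the injection of \<open>M\<close> into \<open>verts G - S\<close>
  surjective, so \<open>v\<close> is the chosen end of an edge. If the other end were outside
  \<open>S\<close> too, it would be the chosen end of the same edge, which has only one.\<close>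

lemma tight_cover:
  assumes G: "simple_graph G" and S: "indep_set G S" and M: "matching G M"
    and tight: "card S + card M = num_verts G" and v: "v \<in> verts G - S"
  obtains s where "s \<in> S" "{v, s} \<in> M"
proof -
  obtain g where g: "inj_on g M" "g ` M \<subseteq> verts G - S" "\<And>e. e \<in> M \<Longrightarrow> g e \<in> e"
    using matching_into_compl_indep[OF G S M] by blast
  have "card (g ` M) = card (verts G - S)"
    using card_image[OF g(1)] tight card_compl_indep[OF G S] by linarith
  then have img: "g ` M = verts G - S"
    using g(2) finite_verts[OF G] by (simp add: card_subset_eq)
  then obtain e where e: "e \<in> M" "v = g e" using v by blast
  then obtain u w where uw: "e = {u, w}" "u \<noteq> w" "u \<in> verts G" "w \<in> verts G"
    using edgeE[OF G, of e] M by (auto simp: matching_def)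
  then obtain s where s: "e = {v, s}" "s \<in> verts G" "s \<noteq> v"
    using g(3)[OF e(1)] e(2) by (metis insert_commute insertE singletonD)
  have "s \<in> S"
  proof (rule ccontr)
    assume "s \<notin> S"
    then obtain e' where e': "e' \<in> M" "s = g e'" using s(2) img by blast
    then have "e' = e" using matching_edge_unique[OF M e'(1) e(1), of s] g(3) s(1) by auto
    then show False using e e' s(3) by simp
  qed
  then show ?thesis using that s e by blast
qed

lemma tight_edge_meets:
  assumes G: "simple_graph G" and S: "indep_set G S" and M: "matching G M"
    and tight: "card S + card M = num_verts G" and e: "e \<in> M"
  obtains v where "v \<in> e" "v \<in> S"
proof -
  have "e \<in> edges G" using M e by (auto simp: matching_def)
  then obtain u where u: "u \<in> e" "u \<in> verts G - S" using edge_leaves_indep[OF G S] by blast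
  then obtain s where "s \<in> S" "{u, s} \<in> M" using tight_cover[OF G S M tight] by blast
  moreover from this have "{u, s} = e"
    using matching_edge_unique[OF M _ e, of "{u, s}" u] u(1) by simp
  ultimately show ?thesis using that by blast
qed

text \<open>Turns distinct representatives from \<open>hall\<close> into a matching. Disjointness of
  \<open>B\<close> from its image prevents edges from meeting crosswise.\<close>

lemma matching_of_inj:
  assumes G: "simple_graph G" and "finite B" "inj_on f B" "f ` B \<inter> B = {}"
    and "\<And>b. b \<in> B \<Longrightarrow> {f b, b} \<in> edges G"
  shows "matching G ((\<lambda>b. {f b, b}) ` B)" "card ((\<lambda>b. {f b, b}) ` B) = card B"
proof -
  show "matching G ((\<lambda>b. {f b, b}) ` B)"
    unfolding matching_def pairwise_def disjnt_def
  proof (intro conjI ballI impI)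
    fix p q
    assume "p \<in> (\<lambda>b. {f b, b}) ` B" "q \<in> (\<lambda>b. {f b, b}) ` B" "p \<noteq> q"
    then obtain b c where "b \<in> B" "c \<in> B" "p = {f b, b}" "q = {f c, c}" "b \<noteq> c" by blast
    moreover from this have "f b \<noteq> f c" "f b \<noteq> c" "f c \<noteq> b"
      using assms(3,4) by (auto dest: inj_onD)
    ultimately show "p \<inter> q = {}" by auto
  qed (use assms(5) in auto)
  have "inj_on (\<lambda>b. {f b, b}) B"
    using assms(4) by (intro inj_onI) (metis IntI doubleton_eq_iff empty_iff image_eqI)
  then show "card ((\<lambda>b. {f b, b}) ` B) = card B" by (rule card_image)
qed

section \<open>Deleting an edge\<close>

lemma delete_edge_simps [simp]:
  "verts (delete_edge G e) = verts G" "edges (delete_edge G e) = edges G - {e}"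
  "num_verts (delete_edge G e) = num_verts G"
  by (auto simp: delete_edge_def num_verts_def)

lemma simple_graph_delete_edge: "simple_graph G \<Longrightarrow> simple_graph (delete_edge G e)"
  by (auto simp: simple_graph_def)

lemma matching_delete_edge: "matching (delete_edge G e) M \<longleftrightarrow> matching G M \<and> e \<notin> M"
  by (auto simp: matching_def)

text \<open>A matching that avoids \<open>e\<close> survives the deletion of \<open>e\<close>. This
  serves both to refute criticality and to collect all critical edges in one matching.\<close>

lemma mu_critical_in_max_matching:
  assumes "simple_graph G" "e \<in> mu_critical_edges G" "matching G M" "matching_num G \<le> card M"
  shows "e \<in> M"
proof (rule ccontr)
  assume "e \<notin> M"
  then have "card M \<le> matching_num (delete_edge G e)"
    using assms(1,3) by (intro card_le_matching_num simple_graph_delete_edge)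
      (auto simp: matching_delete_edge)
  then show False using assms(2,4) by (auto simp: mu_critical_edges_def)
qed

section \<open>Critical sets\<close>

lemma set_difference_le:
  assumes "simple_graph G" "A \<subseteq> verts G"
  shows "set_difference G A \<le> critical_difference G"
  unfolding critical_difference_def using assms finite_verts by (intro Max_ge) auto

lemma critical_difference_attained:
  assumes "simple_graph G"
  obtains A where "A \<subseteq> verts G" "set_difference G A = critical_difference G"
proof -
  have "critical_difference G \<in> set_difference G ` {A. A \<subseteq> verts G}"
    unfolding critical_difference_def using assms finite_verts by (intro Max_in) auto
  then show ?thesis using that by auto
qed

lemma critical_indep_setI:
  "simple_graph G \<Longrightarrow> indep_set G A \<Longrightarrow> critical_difference G \<le> set_difference G A \<Longrightarrow>
    critical_indep_set G A"
  using set_difference_le[of G A] by (auto simp: critical_indep_set_def indep_set_def)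

text \<open>From an optimal \<open>X\<close>, deleting \<open>X \<inter> nbhd G X\<close> leaves an
  independent set whose neighbourhood avoids \<open>X\<close>, so at least as many neighbours as
  vertices are lost.\<close>

lemma critical_indep_set_exists:
  assumes G: "simple_graph G"
  obtains A where "critical_indep_set G A"
proof -
  obtain X where X: "X \<subseteq> verts G" "set_difference G X = critical_difference G"
    using critical_difference_attained[OF G] .
  define A where "A = X - nbhd G X"
  have finX: "finite X" using X(1) finite_verts[OF G] finite_subset by blast
  have "indep_set G A"
    using X(1) G by (auto simp: A_def indep_set_def in_nbhd_iff)
  moreover have "nbhd G A \<subseteq> nbhd G X - X"
    using G by (auto simp: A_def in_nbhd_iff) (metis insert_commute)
  then have "card (nbhd G A) \<le> card (nbhd G X - X)"
    using finite_nbhd[OF G] by (intro card_mono) auto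
  moreover have "card (nbhd G X - X) + card (X \<inter> nbhd G X) = card (nbhd G X)"
    using finite_nbhd[OF G] finX
    by (metis Int_commute add.commute card_Int_Diff)
  moreover have "card A + card (X \<inter> nbhd G X) = card X"
    unfolding A_def using finX by (metis add.commute card_Int_Diff)
  ultimately have "critical_indep_set G A"
    using X(2) by (intro critical_indep_setI[OF G]) (auto simp: set_difference_def)
  then show ?thesis by (rule that)
qed

lemma set_difference_supermodular:
  assumes G: "simple_graph G" and "A \<subseteq> verts G" "B \<subseteq> verts G"
  shows "set_difference G A + set_difference G B
    \<le> set_difference G (A \<inter> B) + set_difference G (A \<union> B)"
proof -
  have fin: "finite A" "finite B" using assms finite_verts finite_subset by metis+
  have "nbhd G (A \<union> B) = nbhd G A \<union> nbhd G B" by (auto simp: nbhd_def)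
  moreover have "card (nbhd G (A \<inter> B)) \<le> card (nbhd G A \<inter> nbhd G B)"
    using finite_nbhd[OF G] by (intro card_mono) (auto simp: nbhd_def)
  ultimately show ?thesis
    using card_Un_Int[OF fin] card_Un_Int[OF finite_nbhd[OF G, of A] finite_nbhd[OF G, of B]]
    by (simp add: set_difference_def)
qed

text \<open>The union need not be independent, but \<open>critical_difference\<close> bounds it too,
  being a maximum over all vertex sets; supermodularity then leaves no loss for the
  intersection.\<close>

lemma critical_indep_set_Int:
  assumes G: "simple_graph G" and A: "critical_indep_set G A" and B: "critical_indep_set G B"
  shows "critical_indep_set G (A \<inter> B)"
proof (rule critical_indep_setI[OF G])
  show "indep_set G (A \<inter> B)" using A by (auto simp: critical_indep_set_def indep_set_def)
  have sub: "A \<subseteq> verts G" "B \<subseteq> verts G"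
    using A B by (auto simp: critical_indep_set_def indep_set_def)
  then show "critical_difference G \<le> set_difference G (A \<inter> B)"
    using set_difference_supermodular[OF G sub] set_difference_le[OF G, of "A \<union> B"] A B
    by (auto simp: critical_indep_set_def)
qed

text \<open>A critical independent set of least size lies in every other one, since intersecting
  cannot shrink it.\<close>

lemma critical_indep_set_ker:
  assumes G: "simple_graph G"
  shows "critical_indep_set G (ker G)"
proof -
  obtain A where A: "critical_indep_set G A"
    and min: "\<And>B. critical_indep_set G B \<Longrightarrow> card A \<le> card B"
    using critical_indep_set_exists[OF G] ex_has_least_nat[of "critical_indep_set G" _ card]
    by metis
  have "A \<subseteq> B" if "critical_indep_set G B" for B
  proof -
    have "card A \<le> card (A \<inter> B)" using min critical_indep_set_Int[OF G A that] .
    moreover have "finite A" using A finite_indep[OF G] by (auto simp: critical_indep_set_def)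
    ultimately show ?thesis by (metis card_seteq inf_le1 le_iff_inf)
  qed
  then have "ker G = A" using A by (auto simp: ker_def)
  then show ?thesis using A by simp
qed

text \<open>Removing \<open>?Q\<close> from the kernel frees all neighbours in \<open>J\<close>. If
  \<open>?Q\<close> were no larger than \<open>J\<close>, the rest would be a critical independent
  set properly inside the kernel.\<close>

lemma ker_surplus:
  assumes G: "simple_graph G" and J: "J \<subseteq> nbhd G (ker G)" "J \<noteq> {}"
  shows "card J < card {a \<in> ker G. \<exists>b\<in>J. {a, b} \<in> edges G}" (is "_ < card ?Q")
proof (rule ccontr)
  assume neg: "\<not> ?thesis"
  have crit: "critical_indep_set G (ker G)" by (rule critical_indep_set_ker[OF G])
  have fin: "finite (ker G)" using crit finite_indep[OF G] by (auto simp: critical_indep_set_def)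
  have "nbhd G (ker G - ?Q) \<subseteq> nbhd G (ker G) - J"
    using G by (auto simp: in_nbhd_iff)
  then have "card (nbhd G (ker G - ?Q)) \<le> card (nbhd G (ker G) - J)"
    using finite_nbhd[OF G] by (intro card_mono) auto
  moreover have "card (nbhd G (ker G) - J) + card J = card (nbhd G (ker G))"
    using J(1) finite_nbhd[OF G]
    by (metis card_Diff_subset card_mono finite_subset le_add_diff_inverse2)
  moreover have "card (ker G - ?Q) + card ?Q = card (ker G)"
    using card_Int_Diff[OF fin, of ?Q] by (simp add: Int_def)
  moreover have "indep_set G (ker G - ?Q)"
    using crit by (auto simp: critical_indep_set_def indep_set_def)
  ultimately have "critical_indep_set G (ker G - ?Q)"
    using neg crit by (intro critical_indep_setI[OF G])
      (auto simp: set_difference_def critical_indep_set_def)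
  then have "ker G \<subseteq> ker G - ?Q" by (auto simp: ker_def)
  moreover have "?Q \<noteq> {}" using J G by (auto simp: in_nbhd_iff)
  ultimately show False by blast
qed

text \<open>A matching of \<open>nbhd G (ker G)\<close> into the kernel that misses \<open>x\<close>
  replaces, without loss, the edges of a maximum matching that meet this neighbourhood. The result
  is a maximum matching without \<open>{x, y}\<close>.\<close>

lemma nbhd_ker_not_mu_critical:
  assumes G: "simple_graph G" and e: "{x, y} \<in> mu_critical_edges G"
  shows "y \<notin> nbhd G (ker G)"
proof
  assume y: "y \<in> nbhd G (ker G)"
  let ?K = "ker G" and ?N = "nbhd G (ker G)"
  have ind: "indep_set G ?K"
    using critical_indep_set_ker[OF G] by (simp add: critical_indep_set_def)
  have disj: "?K \<inter> ?N = {}" using ind G by (auto simp: indep_set_def in_nbhd_iff)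
  have finK: "finite ?K" using finite_indep[OF G ind] .
  \<comment> \<open>\<open>x\<close> is barred as a partner; the strict inequality in
    \<open>ker_surplus\<close> keeps Hall's condition valid.\<close>
  define A where "A = (\<lambda>b. {a \<in> ?K - {x}. {a, b} \<in> edges G})"
  have "\<exists>f. inj_on f ?N \<and> (\<forall>b\<in>?N. f b \<in> A b)"
  proof (rule hall)
    fix J assume J: "J \<subseteq> ?N"
    show "card J \<le> card (\<Union>(A ` J))"
    proof (cases "J = {}")
      case False
      have "\<Union>(A ` J) = {a \<in> ?K. \<exists>b\<in>J. {a, b} \<in> edges G} - {x}" by (auto simp: A_def)
      then show ?thesis using ker_surplus[OF G J False] by (auto simp: card_Diff_singleton_if)
    qed simp
  qed (auto simp: A_def finK finite_nbhd[OF G])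
  then obtain f where f: "inj_on f ?N" "\<And>b. b \<in> ?N \<Longrightarrow> f b \<in> ?K - {x}"
    "\<And>b. b \<in> ?N \<Longrightarrow> {f b, b} \<in> edges G"
    by (auto simp: A_def)
  define M0 where "M0 = (\<lambda>b. {f b, b}) ` ?N"
  have M0: "matching G M0" "card M0 = card ?N"
    using matching_of_inj[OF G finite_nbhd[OF G] f(1)] f disj unfolding M0_def by blast+
  obtain M where M: "matching G M" "card M = matching_num G" using max_matching_exists[OF G] .
  define M1 where "M1 = {e \<in> M. e \<inter> ?N = {}}"
  have finM: "finite M" using finite_matching[OF G M(1)] .
  \<comment> \<open>An end in the kernel would force the other end into \<open>?N\<close>.\<close>
  have M1K: "e \<inter> (?K \<union> ?N) = {}" if "e \<in> M1" for e
  proof -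
    have "e \<in> edges G" "e \<inter> ?N = {}" using that M(1) by (auto simp: M1_def matching_def)
    then obtain u v where "e = {u, v}" "{u, v} \<in> edges G" "{v, u} \<in> edges G"
      using edgeE[OF G, of e] by (metis insert_commute)
    then show ?thesis using \<open>e \<inter> ?N = {}\<close> G by (auto simp: in_nbhd_iff)
  qed
  have M0K: "e \<subseteq> ?K \<union> ?N" "e \<inter> ?N \<noteq> {}" if "e \<in> M0" for e
    using that f(2) by (auto simp: M0_def)
  have disj01: "M0 \<inter> M1 = {}" using M1K M0K(2) by blast
  have "matching G (M0 \<union> M1)"
    unfolding matching_def
  proof
    show "M0 \<union> M1 \<subseteq> edges G" using M0(1) M(1) by (auto simp: matching_def M1_def)
    have "disjnt p q" if "p \<in> M0" "q \<in> M1" for p q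
      using M0K(1)[OF that(1)] M1K[OF that(2)] by (auto simp: disjnt_def)
    then show "pairwise disjnt (M0 \<union> M1)"
      using M0(1) M(1) unfolding matching_def pairwise_def M1_def
      by (auto dest: disjnt_sym)
  qed
  \<comment> \<open>Each edge of \<open>M\<close> outside \<open>M1\<close> uses its own vertex of
    \<open>?N\<close>, and \<open>M0\<close> has exactly \<open>card ?N\<close> edges.\<close>
  moreover have "card M \<le> card (M0 \<union> M1)"
  proof -
    have "\<forall>e\<in>M - M1. \<exists>v. v \<in> e \<and> v \<in> ?N" by (auto simp: M1_def)
    then obtain h where h: "\<forall>e\<in>M - M1. h e \<in> e \<and> h e \<in> ?N" by metis
    have "inj_on h (M - M1)"
      using h by (intro inj_on_matching[OF M(1)]) auto
    then have "card (M - M1) \<le> card ?N"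
      using h finite_nbhd[OF G] by (intro card_inj_on_le) auto
    moreover have "card M = card M1 + card (M - M1)"
      using card_Int_Diff[OF finM, of M1] by (simp add: M1_def Int_def)
    moreover have "card (M0 \<union> M1) = card M0 + card M1"
      using finite_matching[OF G M0(1)] finM disj01
      by (intro card_Un_disjoint) (auto simp: M1_def)
    ultimately show ?thesis using M0(2) by simp
  qed
  ultimately have "{x, y} \<in> M0 \<union> M1"
    using mu_critical_in_max_matching[OF G e, of "M0 \<union> M1"] M(2) by simp
  moreover have "{x, y} \<notin> M1" using y by (auto simp: M1_def)
  moreover have "{x, y} \<notin> M0"
    using f(2) y disj by (auto simp: M0_def doubleton_eq_iff)
  ultimately show False by blast
qed

text \<open>Partners in \<open>M\<close> inject the matched part of \<open>A\<close> into its
  neighbourhood. Hence the difference of \<open>A\<close> is at most its number of unmatched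
  vertices.\<close>

lemma matched_part_le_nbhd:
  assumes G: "simple_graph G" and M: "matching G M"
  shows "card (A \<inter> \<Union>M) \<le> card (nbhd G A)"
proof -
  have "\<exists>w. {v, w} \<in> M" if v: "v \<in> \<Union>M" for v
  proof -
    obtain e where e: "e \<in> M" "v \<in> e" using v by blast
    then have "e \<in> edges G" using M by (auto simp: matching_def)
    then obtain p q where "e = {p, q}" using edgeE[OF G] by metis
    then have "e = {v, p} \<or> e = {v, q}" using e(2) by auto
    then show ?thesis using e(1) by auto
  qed
  then obtain p where p: "\<And>v. v \<in> \<Union>M \<Longrightarrow> {v, p v} \<in> M" by metis
  have "inj_on p (A \<inter> \<Union>M)"
  proof (rule inj_onI)
    fix u v assume uv: "u \<in> A \<inter> \<Union>M" "v \<in> A \<inter> \<Union>M" "p u = p v"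
    then have "{u, p u} = {v, p v}"
      using matching_edge_unique[OF M p p, of u v "p u"] by auto
    then show "u = v" using uv(3) by (auto simp: doubleton_eq_iff)
  qed
  moreover have "p ` (A \<inter> \<Union>M) \<subseteq> nbhd G A"
    using p M G by (auto simp: in_nbhd_iff matching_def) blast
  ultimately show ?thesis using finite_nbhd[OF G] by (rule card_inj_on_le)
qed

section \<open>Koenig-Egervary graphs\<close>

lemma max_indep_tight:
  assumes "konig_egervary G" "max_indep_set G S" "card M = matching_num G"
  shows "card S + card M = num_verts G"
  using assms by (auto simp: konig_egervary_def max_indep_set_def)

lemma unmatched_subset_max_indep:
  assumes G: "simple_graph G" and KE: "konig_egervary G" and S: "max_indep_set G S"
    and M: "matching G M" "card M = matching_num G"
  shows "verts G - \<Union>M \<subseteq> S"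
proof
  fix v assume v: "v \<in> verts G - \<Union>M"
  have ind: "indep_set G S" using S by (simp add: max_indep_set_def)
  show "v \<in> S"
    using tight_cover[OF G ind M(1) max_indep_tight[OF KE S M(2)], of v] v by blast
qed

text \<open>The difference of any \<open>A\<close> is at most its number of unmatched vertices,
  which all lie in \<open>S\<close>. The difference of \<open>S\<close> is at least its number of
  unmatched vertices: every edge of \<open>M\<close> meets \<open>S\<close>, and only
  \<open>card M\<close> vertices lie outside.\<close>

lemma max_indep_critical:
  assumes G: "simple_graph G" and KE: "konig_egervary G" and S: "max_indep_set G S"
  shows "critical_indep_set G S"
proof (rule critical_indep_setI[OF G])
  show ind: "indep_set G S" using S by (simp add: max_indep_set_def)
  obtain M where M: "matching G M" "card M = matching_num G" using max_matching_exists[OF G] .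
  have tight: "card S + card M = num_verts G" by (rule max_indep_tight[OF KE S M(2)])
  obtain A where A: "A \<subseteq> verts G" "set_difference G A = critical_difference G"
    using critical_difference_attained[OF G] .
  have finA: "finite A" using A(1) finite_verts[OF G] finite_subset by blast
  have finS: "finite S" using finite_indep[OF G ind] .
  have "card (nbhd G S) \<le> card (verts G - S)"
    using ind G finite_verts[OF G]
    by (intro card_mono) (auto simp: indep_set_def in_nbhd_iff dest: edge_verts)
  then have NS: "card (nbhd G S) \<le> card M" using card_compl_indep[OF G ind] tight by simp
  have "card M \<le> card (S \<inter> \<Union>M)"
  proof -
    have "\<forall>e\<in>M. \<exists>v. v \<in> e \<and> v \<in> S" using tight_edge_meets[OF G ind M(1) tight] by metis
    then obtain h where h: "\<forall>e\<in>M. h e \<in> e \<and> h e \<in> S" by metis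
    have "inj_on h M" using h by (intro inj_on_matching[OF M(1)]) auto
    then show ?thesis using h finS by (intro card_inj_on_le[of h]) auto
  qed
  moreover have "card (A - \<Union>M) \<le> card (S - \<Union>M)"
    using A(1) unmatched_subset_max_indep[OF G KE S M] finS by (intro card_mono) auto
  moreover have "card (A \<inter> \<Union>M) \<le> card (nbhd G A)" by (rule matched_part_le_nbhd[OF G M(1)])
  ultimately show "critical_difference G \<le> set_difference G S"
    using A(2) NS card_Int_Diff[OF finA, of "\<Union>M"] card_Int_Diff[OF finS, of "\<Union>M"]
    by (simp add: set_difference_def)
qed

text \<open>Maximum independent sets are critical here, so the kernel is an intersection over a
  larger family.\<close>

lemma ker_subset_core:
  "simple_graph G \<Longrightarrow> konig_egervary G \<Longrightarrow> ker G \<subseteq> core G"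
  using max_indep_critical by (fastforce simp: ker_def core_def)

section \<open>Critical edges at the core, and edges whose deletion destroys the Koenig-Egervary
  property\<close>

lemma indep_core: "simple_graph G \<Longrightarrow> indep_set G (core G)"
  by (rule max_indep_set_exists[of G]) (auto simp: core_def max_indep_set_def indep_set_def)

lemma core_critical_location:
  assumes G: "simple_graph G"
  shows "core_critical_edges G
    \<subseteq> edges_between G (core G - ker G) (nbhd G (core G) - nbhd G (ker G))"
proof
  fix e assume "e \<in> core_critical_edges G"
  then obtain x y where xy: "e = {x, y}" "x \<in> core G" "y \<in> nbhd G (core G)"
    "e \<in> edges G" "e \<in> mu_critical_edges G"
    by (auto simp: core_critical_edges_def edges_between_def)
  then have "y \<notin> nbhd G (ker G)" using nbhd_ker_not_mu_critical[OF G] by blast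
  moreover from this have "x \<notin> ker G" using xy G by (auto simp: in_nbhd_iff)
  ultimately show "e \<in> edges_between G (core G - ker G) (nbhd G (core G) - nbhd G (ker G))"
    using xy by (auto simp: edges_between_def)
qed

text \<open>The critical edges lie in one maximum matching, hence are disjoint, and each has an end
  in \<open>core G - ker G\<close>.\<close>

lemma card_core_critical_le:
  assumes G: "simple_graph G" and KE: "konig_egervary G"
  shows "card (core_critical_edges G) + ker_num G \<le> core_num G"
proof -
  obtain M where M: "matching G M" "card M = matching_num G" using max_matching_exists[OF G] .
  have finC: "finite (core G)" using finite_indep[OF G indep_core[OF G]] .
  have sub: "core_critical_edges G \<subseteq> M"
    using mu_critical_in_max_matching[OF G _ M(1)] M(2) by (auto simp: core_critical_edges_def)
  have "\<forall>e\<in>core_critical_edges G. \<exists>v. v \<in> e \<and> v \<in> core G - ker G"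
    using core_critical_location[OF G] unfolding edges_between_def by blast
  then obtain h where h: "\<forall>e\<in>core_critical_edges G. h e \<in> e \<and> h e \<in> core G - ker G" by metis
  have "inj_on h (core_critical_edges G)"
    using h by (intro inj_on_matching[OF M(1) sub]) auto
  then have "card (core_critical_edges G) \<le> card (core G - ker G)"
    using h finC by (intro card_inj_on_le) auto
  moreover have "card (core G - ker G) + card (ker G) = card (core G)"
    using ker_subset_core[OF G KE] finC
    by (metis card_Diff_subset card_mono finite_subset le_add_diff_inverse2)
  ultimately show ?thesis by (simp add: core_num_def ker_num_def)
qed

text \<open>Deletion costs a maximum matching one edge, so the reduced graph needs an independent
  set larger than \<open>S\<close>. It is assembled from \<open>S\<close> and \<open>T\<close> along
  a Hall violator.\<close>

lemma ke_delete_mu_critical: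
  assumes G: "simple_graph G" and KE: "konig_egervary G"
    and e: "{x, y} \<in> mu_critical_edges G"
    and S: "max_indep_set G S" "x \<notin> S" and T: "max_indep_set G T" "y \<notin> T"
  shows "konig_egervary (delete_edge G {x, y})"
proof -
  have indS: "indep_set G S" and indT: "indep_set G T"
    using S T by (auto simp: max_indep_set_def)
  have finS: "finite S" and finT: "finite T" using finite_indep[OF G] indS indT by auto
  obtain M where M: "matching G M" "card M = matching_num G" using max_matching_exists[OF G] .
  have tS: "card S + card M = num_verts G" and tT: "card T + card M = num_verts G"
    using max_indep_tight[OF KE _ M(2)] S T by auto
  have eM: "{x, y} \<in> M" using mu_critical_in_max_matching[OF G e M(1)] M(2) by simp
  have y: "y \<in> S" using tight_edge_meets[OF G indS M(1) tS eM] S(2) by blast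
  define B where "B = verts G - S"
  have finB: "finite B" using finite_verts[OF G] by (simp add: B_def)
  have cardB: "card B = card M" using card_compl_indep[OF G indS] tS by (simp add: B_def)
  \<comment> \<open>Neighbours in \<open>S\<close> after the deletion. Distinct representatives
    would form a maximum matching of \<open>G\<close> without \<open>{x, y}\<close>, so Hall's
    condition fails.\<close>
  define N where "N = (\<lambda>b. {a \<in> S. {a, b} \<in> edges G - {{x, y}}})"
  obtain J where J: "J \<subseteq> B" "card (\<Union>(N ` J)) < card J"
  proof (rule ccontr)
    assume "\<not> thesis"
    then have "card J \<le> card (\<Union>(N ` J))" if "J \<subseteq> B" for J
      using \<open>\<And>J. J \<subseteq> B \<Longrightarrow> card (\<Union>(N ` J)) < card J \<Longrightarrow> thesis\<close> that by (meson not_le)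
    then have "\<exists>f. inj_on f B \<and> (\<forall>b\<in>B. f b \<in> N b)"
      using finB finS by (intro hall) (auto simp: N_def)
    then obtain f where f: "inj_on f B" "\<And>b. b \<in> B \<Longrightarrow> f b \<in> S"
      "\<And>b. b \<in> B \<Longrightarrow> {f b, b} \<in> edges G - {{x, y}}"
      by (auto simp: N_def)
    have "f ` B \<inter> B = {}" using f(2) by (auto simp: B_def)
    note * = matching_of_inj[OF G finB f(1) this]
    have "{x, y} \<in> (\<lambda>b. {f b, b}) ` B"
      using f(3) * cardB M(2) by (intro mu_critical_in_max_matching[OF G e]) auto
    then show False using f(3) by blast
  qed
  have finJ: "finite J" using J(1) finB finite_subset by blast
  define W where "W = \<Union>(N ` J)"
  \<comment> \<open>With \<open>y\<close> added, \<open>Z\<close> contains all neighbours of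
    \<open>J\<close> in \<open>S\<close> with respect to \<open>G\<close> itself.\<close>
  define Z where "Z = insert y W"
  have WS: "W \<subseteq> S" by (auto simp: W_def N_def)
  have ZS: "Z \<subseteq> S" using WS y by (simp add: Z_def)
  have finW: "finite W" and finZ: "finite Z" using WS ZS finS finite_subset by auto
  have ZN: "a \<in> Z" if "a \<in> S" "b \<in> J" "{a, b} \<in> edges G" for a b
    using that y S(2) by (auto simp: Z_def W_def N_def doubleton_eq_iff)
  have "\<forall>b\<in>J. \<exists>s. s \<in> S \<and> {b, s} \<in> M"
    using J(1) tight_cover[OF G indS M(1) tS] by (metis B_def subsetD)
  then obtain f where f: "\<forall>b\<in>J. f b \<in> S \<and> {b, f b} \<in> M" by metis
  have fZ: "f b \<in> Z" if "b \<in> J" for b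
    using f that M(1) ZN[of "f b" b] by (auto simp: matching_def insert_commute)
  have same: "b = c" if "b \<in> J" "c \<in> J" "{b, f b} = {c, f c}" for b c
    using that f J(1) by (auto simp: B_def doubleton_eq_iff)
  \<comment> \<open>Otherwise the \<open>M\<close>-partners of \<open>J\<close> would be
    \<open>card J\<close> distinct vertices of the smaller set \<open>W\<close>.\<close>
  have yW: "y \<notin> W"
  proof
    assume "y \<in> W"
    then have "f ` J \<subseteq> W" using fZ by (auto simp: Z_def)
    moreover have "inj_on f J"
    proof (rule inj_onI)
      fix b c assume "b \<in> J" "c \<in> J" "f b = f c"
      then show "b = c"
        using same[of b c] f matching_edge_unique[OF M(1), of "{b, f b}" "{c, f c}" "f b"] by auto
    qed
    ultimately have "card J \<le> card W" using finW by (metis card_inj_on_le)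
    then show False using J(2) by (simp add: W_def)
  qed
  have cardZ: "card Z \<le> card J" using yW finW J(2) by (simp add: Z_def W_def)
  \<comment> \<open>\<open>M\<close> matches \<open>J\<close> into \<open>Z\<close>, and each of
    these disjoint edges meets \<open>T\<close>.\<close>
  have JT: "card J \<le> card (T \<inter> (J \<union> Z))"
  proof -
    have "\<forall>b\<in>J. \<exists>v. v \<in> {b, f b} \<and> v \<in> T"
      using f tight_edge_meets[OF G indT M(1) tT] by metis
    then obtain h where h: "\<forall>b\<in>J. h b \<in> {b, f b} \<and> h b \<in> T" by metis
    have "inj_on h J"
    proof (rule inj_onI)
      fix b c assume "b \<in> J" "c \<in> J" "h b = h c"
      then show "b = c"
        using same[of b c] f h matching_edge_unique[OF M(1), of "{b, f b}" "{c, f c}" "h b"]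
        by metis
    qed
    moreover have "h ` J \<subseteq> T \<inter> (J \<union> Z)" using h fZ by fastforce
    ultimately show ?thesis using finT by (intro card_inj_on_le) auto
  qed
  \<comment> \<open>\<open>Z\<close> is exchanged for at least as many vertices of \<open>T\<close>;
    putting back \<open>y\<close>, which \<open>T\<close> omits, gains one.\<close>
  define R where "R = T \<inter> (J \<union> Z) \<union> insert y (S - Z)"
  have disj: "T \<inter> (J \<union> Z) \<inter> insert y (S - Z) = {}"
    using T(2) J(1) by (auto simp: B_def)
  have "card R = card (T \<inter> (J \<union> Z)) + card (insert y (S - Z))"
    unfolding R_def using disj finS finT by (intro card_Un_disjoint) auto
  moreover have "card (insert y (S - Z)) = Suc (card (S - Z))"
    using finS by (simp add: Z_def)
  moreover have "card (S - Z) + card Z = card S"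
    using ZS finS finZ by (metis card_Diff_subset card_mono le_add_diff_inverse2)
  ultimately have cardR: "Suc (card S) \<le> card R" using JT cardZ by linarith
  \<comment> \<open>Neighbours of \<open>J\<close> in \<open>S\<close> lie in \<open>Z\<close>, so
    only \<open>y\<close> could be hit, and a surviving edge from \<open>J\<close> to
    \<open>y\<close> would put \<open>y\<close> into \<open>W\<close>.\<close>
  have cross: "{u, v} \<notin> edges G - {{x, y}}"
    if "u \<in> T \<inter> (J \<union> Z)" "v \<in> insert y (S - Z)" for u v
  proof
    assume edge: "{u, v} \<in> edges G - {{x, y}}"
    have vS: "v \<in> S" using that(2) y by blast
    show False
    proof (cases "u \<in> J")
      case True
      then have "v \<in> Z" using ZN[OF vS, of u] edge by (simp add: insert_commute)
      then have "v = y" using that(2) by blast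
      then have "y \<in> W" using True edge y by (auto simp: W_def N_def insert_commute)
      then show False using yW by simp
    next
      case False
      then have "u \<in> S" using that(1) ZS by blast
      then show False using vS edge indS by (auto simp: indep_set_def)
    qed
  qed
  have "indep_set (delete_edge G {x, y}) R"
    unfolding indep_set_def delete_edge_simps
  proof (intro conjI ballI)
    show "R \<subseteq> verts G" using indS indT y by (auto simp: R_def indep_set_def)
    fix u v assume uv: "u \<in> R" "v \<in> R"
    have "insert y (S - Z) \<subseteq> S" using y by blast
    then show "{u, v} \<notin> edges G - {{x, y}}"
      using uv cross[of u v] cross[of v u] indS indT
      unfolding R_def indep_set_def by (auto simp: insert_commute)
  qed
  moreover have "matching (delete_edge G {x, y}) (M - {{x, y}})"
    using M(1) by (auto simp: matching_delete_edge matching_def pairwise_def)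
  moreover have "card (M - {{x, y}}) + 1 = card M"
    using eM finite_matching[OF G M(1)] by (metis Suc_eq_plus1 card_Suc_Diff1)
  ultimately show ?thesis
    using cardR tS
    by (intro konig_egervaryI(1)[OF simple_graph_delete_edge[OF G]]) auto
qed

text \<open>For a noncritical \<open>e\<close>, a maximum independent set of \<open>G\<close> and a
  maximum matching of the reduced graph are still tight. A critical \<open>e\<close> without an end
  in the core falls under \<open>ke_delete_mu_critical\<close>.\<close>

lemma not_ke_delete_core_critical:
  assumes G: "simple_graph G" and KE: "konig_egervary G"
    and e: "e \<in> edges G" "\<not> konig_egervary (delete_edge G e)"
  shows "e \<in> core_critical_edges G"
proof -
  obtain S where S: "max_indep_set G S" using max_indep_set_exists[OF G] .
  have crit: "e \<in> mu_critical_edges G"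
  proof (rule ccontr)
    assume "e \<notin> mu_critical_edges G"
    then have le: "matching_num G \<le> matching_num (delete_edge G e)"
      using e(1) by (auto simp: mu_critical_edges_def)
    obtain M where "matching (delete_edge G e) M" "card M = matching_num (delete_edge G e)"
      using max_matching_exists[OF simple_graph_delete_edge[OF G]] .
    moreover have "indep_set (delete_edge G e) S"
      using S by (auto simp: max_indep_set_def indep_set_def)
    moreover have "num_verts G \<le> card S + matching_num (delete_edge G e)"
      using le KE S by (simp add: konig_egervary_def max_indep_set_def)
    ultimately show False
      using e(2) konig_egervaryI(1)[OF simple_graph_delete_edge[OF G]] by fastforce
  qed
  obtain x y where xy: "e = {x, y}" using edgeE[OF G e(1)] by metis
  have "x \<in> core G \<or> y \<in> core G"
    using ke_delete_mu_critical[OF G KE] crit e(2) unfolding xy core_def by blast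
  then have "\<exists>a\<in>core G. \<exists>b\<in>nbhd G (core G). e = {a, b}"
    using e(1) in_nbhd_iff[OF G] unfolding xy by (metis insert_commute)
  then have "e \<in> edges_between G (core G) (nbhd G (core G))"
    using e(1) by (simp add: edges_between_def)
  then show ?thesis using crit by (simp add: core_critical_edges_def)
qed

lemma ke_edge_num_ge:
  assumes G: "simple_graph G" and KE: "konig_egervary G"
  shows "num_edges G \<le> ke_edge_num G + card (core_critical_edges G)"
proof -
  let ?K = "{e \<in> edges G. konig_egervary (delete_edge G e)}"
  have "finite (core_critical_edges G)"
    using finite_edges[OF G] by (auto simp: core_critical_edges_def mu_critical_edges_def)
  then have "card (edges G) \<le> card (?K \<union> core_critical_edges G)"
    using not_ke_delete_core_critical[OF G KE] finite_edges[OF G] by (intro card_mono) auto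
  also have "\<dots> \<le> card ?K + card (core_critical_edges G)" by (rule card_Un_le)
  finally show ?thesis by (simp add: num_edges_def ke_edge_num_def)
qed

section \<open>Sharpness of the bound\<close>

text \<open>Each vertex 2i+1 with i > 0 forms a triangle with 0 and 1. A maximum independent set contains
  0 or 1, hence none of these vertices, and so it contains their pendant neighbours 2i. The t
  isolated vertices form the kernel.\<close>

definition pendant_triangles :: "nat \<Rightarrow> nat \<Rightarrow> nat ugraph" where
  "pendant_triangles k t = \<lparr>verts = {..<2 * k + 2 + t},
    edges = (\<lambda>i. {2 * i, 2 * i + 1}) ` {..k} \<union> {{c, 2 * i + 1} | c i. c < 2 \<and> 1 \<le> i \<and> i \<le> k}\<rparr>"

text \<open>Only \<open>k\<close> critical edges have to be exhibited, since
  \<open>card_core_critical_le\<close> gives the reverse inequality.\<close>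

lemma ex_core_critical_sharp:
  "\<exists>H :: nat ugraph. simple_graph H \<and> konig_egervary H \<and> core_num H = k + t \<and> ker_num H = t \<and>
    card (core_critical_edges H) = k"
proof (intro exI conjI)
  define H where "H = pendant_triangles k t"
  \<comment> \<open>This will be a maximum matching; it covers all vertices except the isolated
    ones.\<close>
  define P where "P = (\<lambda>i. {2 * i, 2 * i + 1}) ` {..k}"
  define I where "I = {2 * k + 2..<2 * k + 2 + t}"
  \<comment> \<open>For \<open>c\<close> equal to 0 or 1 these are maximum independent sets, and
    their intersection bounds the core from above.\<close>
  define S where "S = (\<lambda>c. insert c ((\<lambda>i. 2 * i) ` {1..k} \<union> I))"
  have V: "verts H = {..<2 * k + 2 + t}" by (simp add: H_def pendant_triangles_def)
  have E: "edges H = P \<union> {{c, 2 * i + 1} | c i. c < 2 \<and> 1 \<le> i \<and> i \<le> k}"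
    by (simp add: H_def P_def pendant_triangles_def)
  have edge_form: "\<exists>d i. e = {d, 2 * i + 1} \<and> i \<le> k \<and> (d = 2 * i \<or> d < 2 \<and> 1 \<le> i)"
    if "e \<in> edges H" for e
    using that unfolding E P_def by blast
  have bound: "v < 2 * k + 2" if "e \<in> edges H" "v \<in> e" for e v
    using that by (auto simp: E P_def)
  show G: "simple_graph H"
    unfolding simple_graph_def
  proof (intro conjI ballI)
    fix e assume e: "e \<in> edges H"
    show "e \<subseteq> verts H" using bound[OF e] by (fastforce simp: V)
    show "card e = 2" using e by (auto simp: E P_def card_insert_if)
  qed (simp add: V)
  have P: "matching H P"
    by (auto simp: matching_def E P_def pairwise_def disjnt_def) presburger+
  have cardP: "card P = k + 1"
    unfolding P_def by (subst card_image) (auto simp: inj_on_def doubleton_eq_iff)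
  have unmatched: "verts H - \<Union>P = I"
  proof -
    have "v \<in> \<Union>P" if "v < 2 * k + 2" for v
    proof -
      have "v = 2 * (v div 2) \<or> v = 2 * (v div 2) + 1" "v div 2 \<le> k" using that by auto
      then show ?thesis unfolding P_def by blast
    qed
    then have "{..<2 * k + 2} \<subseteq> \<Union>P" by blast
    moreover have "\<Union>P \<subseteq> {..<2 * k + 2}" by (auto simp: P_def)
    ultimately have "\<Union>P = {..<2 * k + 2}" by blast
    then show ?thesis by (auto simp: V I_def)
  qed
  have odd_notin: "2 * i + 1 \<notin> S c" if "c < 2" "1 \<le> i" "i \<le> k" for c i
    using that by (auto simp: S_def I_def) presburger
  have S: "indep_set H (S c)" if c: "c < 2" for c
    unfolding indep_set_def
  proof (intro conjI ballI notI)
    show "S c \<subseteq> verts H" using c by (auto simp: S_def I_def V)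
    fix x y assume xy: "x \<in> S c" "y \<in> S c" "{x, y} \<in> edges H"
    then obtain d i where di: "{x, y} = {d, 2 * i + 1}" "i \<le> k" "d = 2 * i \<or> d < 2 \<and> 1 \<le> i"
      using edge_form by metis
    show False
    proof (cases "i = 0")
      case True
      then have "0 \<in> S c" "1 \<in> S c" using di xy by (auto simp: doubleton_eq_iff)
      then show False using c by (auto simp: S_def I_def)
    next
      case False
      then show False using odd_notin[OF c, of i] di xy by (auto simp: doubleton_eq_iff)
    qed
  qed
  have cardC: "card ((\<lambda>i. 2 * i) ` {1..k} \<union> I) = k + t"
  proof -
    have "card ((\<lambda>i::nat. 2 * i) ` {1..k}) = k" by (subst card_image) (auto simp: inj_on_def)
    then show ?thesis by (subst card_Un_disjoint) (auto simp: I_def)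
  qed
  have cardS: "card (S c) = k + t + 1" if "c < 2" for c
  proof -
    have "c \<notin> (\<lambda>i. 2 * i) ` {1..k} \<union> I" using that by (auto simp: I_def)
    then show ?thesis using cardC by (simp add: S_def I_def)
  qed
  have "num_verts H \<le> card (S 0) + card P" by (simp add: num_verts_def V cardP cardS)
  note KE = konig_egervaryI[OF G S[OF zero_less_numeral] P this]
  show ke: "konig_egervary H" by (rule KE)
  have Pmax: "card P = matching_num H" and mu: "matching_num H = k + 1"
    using KE cardP by simp_all
  have alpha: "indep_num H = k + t + 1" using KE cardS by simp
  have maxS: "max_indep_set H (S c)" if "c < 2" for c
    using S[OF that] cardS[OF that] alpha by (simp add: max_indep_set_def)
  have core: "core H = (\<lambda>i. 2 * i) ` {1..k} \<union> I"
  proof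
    have "core H \<subseteq> S 0 \<inter> S 1" using maxS[of 0] maxS[of 1] by (auto simp: core_def)
    also have "\<dots> = (\<lambda>i. 2 * i) ` {1..k} \<union> I" by (auto simp: S_def)
    finally show "core H \<subseteq> (\<lambda>i. 2 * i) ` {1..k} \<union> I" .
    have "(\<lambda>i. 2 * i) ` {1..k} \<union> I \<subseteq> T" if T: "max_indep_set H T" for T
    proof -
      have indT: "indep_set H T" using T by (simp add: max_indep_set_def)
      have tight: "card T + card P = num_verts H"
        by (rule max_indep_tight[OF ke T Pmax])
      have meets: "2 * i \<in> T \<or> 2 * i + 1 \<in> T" if "i \<le> k" for i
        using tight_edge_meets[OF G indT P tight, of "{2 * i, 2 * i + 1}"] that
        by (auto simp: P_def)
      have "2 * i \<in> T" if i: "1 \<le> i" "i \<le> k" for i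
      proof (rule ccontr)
        assume "2 * i \<notin> T"
        then have "2 * i + 1 \<in> T" using meets i by blast
        moreover obtain c :: nat where "c < 2" "c \<in> T"
          using meets[of 0] that[of 0] that[of 1] by auto
        moreover from this have "{c, 2 * i + 1} \<in> edges H" using i unfolding E by blast
        ultimately show False using indT by (auto simp: indep_set_def)
      qed
      moreover have "I \<subseteq> T"
        using unmatched_subset_max_indep[OF G ke T P Pmax] unmatched by simp
      ultimately show ?thesis by auto
    qed
    then show "(\<lambda>i. 2 * i) ` {1..k} \<union> I \<subseteq> core H" by (auto simp: core_def)
  qed
  then show "core_num H = k + t" using cardC by (simp add: core_num_def)
  have ker: "ker H = I"
  proof
    have "nbhd H I = {}" using bound by (fastforce simp: nbhd_def I_def)
    then have diffI: "set_difference H I = int t" by (simp add: set_difference_def I_def)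
    \<comment> \<open>Matched vertices are outweighed by their partners, so only vertices of
      \<open>I\<close> can count; this makes \<open>I\<close> critical and forces it into every
      critical set.\<close>
    have le: "set_difference H A \<le> int (card (A - \<Union>P))" if "A \<subseteq> verts H" for A
    proof -
      have "finite A" using that V finite_subset by auto
      then show ?thesis
        using matched_part_le_nbhd[OF G P, of A] card_Int_Diff[of A "\<Union>P"]
        by (simp add: set_difference_def)
    qed
    have sub: "A - \<Union>P \<subseteq> I" if "A \<subseteq> verts H" for A using that unmatched by blast
    have finI: "finite I" and cardI: "card I = t" by (auto simp: I_def)
    obtain A where A: "A \<subseteq> verts H" "set_difference H A = critical_difference H"
      using critical_difference_attained[OF G] .
    have "critical_difference H \<le> set_difference H I"
      using le[OF A(1)] card_mono[OF finI sub[OF A(1)]] A(2) diffI cardI by simp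
    moreover have "indep_set H I" using bound by (fastforce simp: indep_set_def I_def V)
    ultimately have "critical_indep_set H I" by (intro critical_indep_setI[OF G])
    then show "ker H \<subseteq> I" by (auto simp: ker_def)
    have "I \<subseteq> B" if B: "critical_indep_set H B" for B
    proof -
      have BV: "B \<subseteq> verts H" using B by (simp add: critical_indep_set_def indep_set_def)
      have "set_difference H I \<le> critical_difference H"
        by (rule set_difference_le[OF G]) (auto simp: I_def V)
      then have "card I \<le> card (B - \<Union>P)"
        using le[OF BV] B diffI cardI by (simp add: critical_indep_set_def)
      then have "B - \<Union>P = I" using card_seteq[OF finI sub[OF BV]] by simp
      then show ?thesis by blast
    qed
    then show "I \<subseteq> ker H" by (auto simp: ker_def)
  qed
  then show kernum: "ker_num H = t" by (simp add: ker_num_def I_def)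
  have "{2 * i, 2 * i + 1} \<in> core_critical_edges H" if i: "1 \<le> i" "i \<le> k" for i
  proof -
    let ?e = "{2 * i, 2 * i + 1}"
    have eE: "?e \<in> edges H" using i by (auto simp: E P_def)
    have "2 * i \<in> core H" using i by (auto simp: core)
    moreover from this have "2 * i + 1 \<in> nbhd H (core H)" using eE G by (auto simp: in_nbhd_iff)
    ultimately have "?e \<in> edges_between H (core H) (nbhd H (core H))"
      using eE by (auto simp: edges_between_def)
    moreover have "matching_num (delete_edge H ?e) < matching_num H"
    proof (rule ccontr)
      assume neg: "\<not> ?thesis"
      obtain M where M: "matching (delete_edge H ?e) M" "card M = matching_num (delete_edge H ?e)"
        using max_matching_exists[OF simple_graph_delete_edge[OF G]] .
      have MH: "matching H M" "?e \<notin> M" using M(1) by (auto simp: matching_delete_edge)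
      have cardM: "card M = k + 1"
        using neg M(2) card_le_matching_num[OF G MH(1)] mu by simp
      have tight: "card (S 0) + card M = num_verts H"
        using cardM by (simp add: cardS num_verts_def V)
      \<comment> \<open>Without this edge, both 1 and 2i+1 can only be matched into \<^term>\<open>S 0\<close> by using the vertex 0.\<close>
      have zero: "{v, 0} \<in> M" if v: "v = 1 \<or> v = 2 * i + 1" for v
      proof -
        have "v \<in> verts H - S 0" using v odd_notin[of 0 i] i by (auto simp: V S_def I_def)
        then obtain s where s: "s \<in> S 0" "{v, s} \<in> M"
          using tight_cover[OF G S MH(1) tight] by auto
        then have "{v, s} \<in> edges H" using MH(1) by (auto simp: matching_def)
        then obtain d j where dj: "{v, s} = {d, 2 * j + 1}" "j \<le> k"
          "d = 2 * j \<or> d < 2 \<and> 1 \<le> j"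
          using edge_form by metis
        have "s \<noteq> 2 * j + 1"
        proof (cases "j = 0")
          case True
          then show ?thesis using s(1) by (auto simp: S_def I_def)
        next
          case False
          then show ?thesis using odd_notin[of 0 j] dj(2) s(1) by auto
        qed
        then have sd: "s = d" "v = 2 * j + 1" using dj(1) by (auto simp: doubleton_eq_iff)
        have "d \<noteq> 1" using sd s(1) by (auto simp: S_def I_def)
        moreover have "d \<noteq> 2 * j \<or> j = 0" using sd s(2) MH(2) v by (auto simp: insert_commute)
        ultimately have "d = 0" using dj(3) by auto
        then show ?thesis using s(2) sd by simp
      qed
      then have "{1, 0} = {2 * i + 1, 0}"
        using matching_edge_unique[OF MH(1), of "{1, 0}" "{2 * i + 1, 0}" 0] by simp
      then show False using i by (auto simp: doubleton_eq_iff)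
    qed
    ultimately show ?thesis
      using eE by (simp add: core_critical_edges_def mu_critical_edges_def)
  qed
  then have "(\<lambda>i. {2 * i, 2 * i + 1}) ` {1..k} \<subseteq> core_critical_edges H" by auto
  moreover have "finite (core_critical_edges H)"
    using finite_edges[OF G] by (auto simp: core_critical_edges_def mu_critical_edges_def)
  moreover have "card ((\<lambda>i::nat. {2 * i, 2 * i + 1}) ` {1..k}) = k"
    by (subst card_image) (auto simp: inj_on_def doubleton_eq_iff)
  ultimately have "k \<le> card (core_critical_edges H)" by (metis card_mono)
  then show "card (core_critical_edges H) = k"
    using card_core_critical_le[OF G ke] kernum \<open>core_num H = k + t\<close> by simp
qed

text \<open>The maximum in (iv) is expressed as a bound for \<open>G\<close> and a graph with the
  same \<open>core_num\<close> and \<open>ker_num\<close> that attains it. Integers avoid truncated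
  subtraction.\<close>

theorem theorem4p8:
  fixes G :: "'a ugraph"
  assumes "simple_graph G" and "konig_egervary G"
  shows
    "(mu_critical_edges G \<inter> edges_between G (ker G) (nbhd G (ker G)) = {}) \<and>
     (mu_critical_edges G \<inter> edges_between G (core G - ker G) (nbhd G (ker G)) = {}) \<and>
     (core_critical_edges G
           \<subseteq> edges_between G (core G - ker G) (nbhd G (core G) - nbhd G (ker G))) \<and>
     (int (card (core_critical_edges G)) \<le> int (core_num G) - int (ker_num G) \<and>
         (\<exists>H :: nat ugraph. simple_graph H \<and> konig_egervary H \<and>
            core_num H = core_num G \<and> ker_num H = ker_num G \<and>
            int (card (core_critical_edges H)) = int (core_num G) - int (ker_num G))) \<and>
     (int (ke_edge_num G) \<ge> int (num_edges G) - int (core_num G) + int (ker_num G))"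
proof (intro conjI)
  \<comment> \<open>(i) and (ii) differ only in the first vertex set, which may be
    arbitrary.\<close>
  have none: "mu_critical_edges G \<inter> edges_between G A (nbhd G (ker G)) = {}" for A
    using nbhd_ker_not_mu_critical[OF assms(1)] by (auto simp: edges_between_def)
  show "mu_critical_edges G \<inter> edges_between G (ker G) (nbhd G (ker G)) = {}"
    and "mu_critical_edges G \<inter> edges_between G (core G - ker G) (nbhd G (ker G)) = {}"
    by (rule none)+
  show "core_critical_edges G
      \<subseteq> edges_between G (core G - ker G) (nbhd G (core G) - nbhd G (ker G))"
    by (rule core_critical_location[OF assms(1)])
  have le: "card (core_critical_edges G) + ker_num G \<le> core_num G"
    by (rule card_core_critical_le[OF assms])
  then show "int (card (core_critical_edges G)) \<le> int (core_num G) - int (ker_num G)" by simp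
  show "\<exists>H :: nat ugraph. simple_graph H \<and> konig_egervary H \<and>
      core_num H = core_num G \<and> ker_num H = ker_num G \<and>
      int (card (core_critical_edges H)) = int (core_num G) - int (ker_num G)"
    using ex_core_critical_sharp[of "core_num G - ker_num G" "ker_num G"] le
    by (auto simp: of_nat_diff)
  show "int (ke_edge_num G) \<ge> int (num_edges G) - int (core_num G) + int (ker_num G)"
    using ke_edge_num_ge[OF assms] le by simp
qed

end
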